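(* Every bounded linear operator $T\colon\mathfrak X_k\to\mathfrak X_k$ has a non-trivial closed invariant subspace (i.e. a closed subspace $Y$ with $\{0\}\ne Y\ne\mathfrak X_k$ and $TY\subseteq Y$).
   Context: Here $k\ge2$ is an integer, and $\mathfrak X_k$ is a real separable $\mathscr L_\infty$-space with a bounded linear operator $S\colon\mathfrak X_k\to\mathfrak X_k$ such that: (1) $\mathfrak X_k$ is hereditarily indecomposable and $\mathfrak X_k^*$ is isomorphic to $\ell_1$; (2) $S$ is non-compact, $S^j\ne0$ for $1\le j<k$ and $S^k=0$; (3) for $0\le j\le k-1$, $S^j$ is not a compact perturbation of any linear combination of the operators $S^l$, $0\le l\le k-1$, $l\ne j$; (4) $S$ is strictly singular; (5) every bounded linear operator $T$ on $\mathfrak X_k$ can be written $T=\sum_{i=0}^{k-1}\lambda_iS^i+K$ with $\lambda_i\in\mathbb R$ and $K$ compact. *)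

theory Defs
  imports "HOL-Analysis.Analysis"
begin

definition fin_dim :: "'a::real_vector set \<Rightarrow> bool" where
  "fin_dim V \<longleftrightarrow> (\<exists>B. finite B \<and> V \<subseteq> span B)"

(* The n-dimensional sup-norm space, as the subspace of the space of bounded real sequences
   (the bounded continuous functions on the discrete space nat, with the supremum norm)
   whose terms vanish from index n on. *)
definition linf_n :: "nat \<Rightarrow> (nat \<Rightarrow>\<^sub>C real) set" where
  "linf_n n = {f. \<forall>i\<ge>n. apply_bcontfun f i = 0}"

(* u restricts to a linear bijection of G onto E with norm(u|G) * norm((u|G)^{-1}) at most lam.
   Requiring u to be linear on the whole space is no restriction: a linear map on a subspace
   always extends linearly, and only the values of u on G are constrained. *)
definition isomorphic_with_constant ::
    "real \<Rightarrow> 'a::real_normed_vector set \<Rightarrow> 'b::real_normed_vector set \<Rightarrow> bool" where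
  "isomorphic_with_constant lam G E \<longleftrightarrow>
     (\<exists>u a b. linear u \<and> bij_betw u G E \<and> 0 \<le> a \<and> 0 \<le> b \<and> a * b \<le> lam \<and>
        (\<forall>x\<in>G. norm (u x) \<le> a * norm x \<and> norm x \<le> b * norm (u x)))"

(* Lindenstrauss-Pelczynski script-L-infinity spaces; n is necessarily the dimension of G. *)
definition script_L_infinity_space :: "'a::real_normed_vector itself \<Rightarrow> bool" where
  "script_L_infinity_space _ \<longleftrightarrow>
     (\<exists>lam\<ge>1. \<forall>F::'a set. subspace F \<and> fin_dim F \<longrightarrow>
        (\<exists>G n. subspace G \<and> fin_dim G \<and> F \<subseteq> G \<and>
           isomorphic_with_constant lam G (linf_n n)))"

definition decomposable :: "'a::real_normed_vector set \<Rightarrow> bool" where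
  "decomposable Y \<longleftrightarrow>
     (\<exists>Z W. subspace Z \<and> closed Z \<and> \<not> fin_dim Z \<and> subspace W \<and> closed W \<and> \<not> fin_dim W \<and>
        Z \<inter> W = {0} \<and> Y = {z + w | z w. z \<in> Z \<and> w \<in> W})"

definition hereditarily_indecomposable :: "'a::real_normed_vector itself \<Rightarrow> bool" where
  "hereditarily_indecomposable _ \<longleftrightarrow>
     \<not> fin_dim (UNIV :: 'a set) \<and>
     (\<forall>Y::'a set. subspace Y \<and> closed Y \<and> \<not> fin_dim Y \<longrightarrow> \<not> decomposable Y)"

(* Isomorphic in the sense of Banach spaces (not isometric): a linear bijection onto the
   absolutely summable sequences, bounded above and below for the l_1 norm. *)
definition isomorphic_to_l1 :: "'b::real_normed_vector itself \<Rightarrow> bool" where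
  "isomorphic_to_l1 _ \<longleftrightarrow>
     (\<exists>\<Phi> :: 'b \<Rightarrow> nat \<Rightarrow> real.
        (\<forall>n. linear (\<lambda>x. \<Phi> x n)) \<and>
        bij_betw \<Phi> UNIV {a. summable (\<lambda>n. \<bar>a n\<bar>)} \<and>
        (\<exists>c>0. \<exists>C. \<forall>x. c * norm x \<le> (\<Sum>n. \<bar>\<Phi> x n\<bar>) \<and> (\<Sum>n. \<bar>\<Phi> x n\<bar>) \<le> C * norm x))"

definition compact_operator ::
    "('a::real_normed_vector \<Rightarrow> 'b::real_normed_vector) \<Rightarrow> bool" where
  "compact_operator T \<longleftrightarrow> bounded_linear T \<and> compact (closure (T ` cball 0 1))"

definition strictly_singular ::
    "('a::real_normed_vector \<Rightarrow> 'b::real_normed_vector) \<Rightarrow> bool" where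
  "strictly_singular T \<longleftrightarrow> bounded_linear T \<and>
     (\<forall>Y. subspace Y \<and> closed Y \<and> \<not> fin_dim Y \<longrightarrow> \<not> (\<exists>g. homeomorphism Y (T ` Y) T g))"

end

theory Submission
  imports Defs
begin

text \<open>
  Write \<open>T = c\<^sub>0 + Q + K\<close> with \<open>K\<close> compact and \<open>Q\<close> a combination of \<open>S, \<dots>, S\<^sup>k\<^sup>-\<^sup>1\<close>.
  The subspaces invariant under \<open>T\<close> are those invariant under \<open>D = T - c\<^sub>0 = Q + K\<close>.
  As \<open>S\<close> is a factor of \<open>Q\<close> commuting with the other one, \<open>Q\<^sup>k = 0\<close>
  (\<open>polynomial_nilpotent\<close>), so \<open>M = D\<^sup>k\<close> is a compact operator
  (\<open>funpow_compact_perturbation\<close>), and it commutes with \<open>D\<close>.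
  If \<open>D = 0\<close>, then \<open>ker S\<close> is invariant under \<open>T\<close>; if \<open>D \<noteq> 0\<close> and \<open>M = 0\<close>, then
  \<open>ker D\<close> is; in each case it is the kernel of a nonzero nilpotent operator, hence non-trivial.
  If \<open>M \<noteq> 0\<close>, Lomonosov's theorem applies.

  Lomonosov's argument is used in a form valid over the reals.  If \<open>D\<close> has no non-trivial
  closed invariant subspace, every nonzero vector has a dense orbit under the commutant of \<open>D\<close>
  (\<open>commutant_orbit_dense\<close>).  Choose a closed ball whose image under \<open>M\<close> stays away from
  \<open>0\<close>.  By compactness finitely many operators of the commutant suffice to send each point of
  this image back into the ball; a partition of unity glues them to a continuous map of the ball
  into a compact part of itself, and Schauder's theorem yields an operator \<open>A\<close> of the commutant
  and \<open>x \<noteq> 0\<close> with \<open>A M x = x\<close> (\<open>lomonosov_fixed_vector\<close>).  The space of all fixed vectors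
  of \<open>A M\<close> is closed, nonzero and invariant under \<open>D\<close>, hence the whole space, so the identity
  \<open>A M\<close> is compact.  But the identity is \<open>S\<^sup>0\<close>, which is not a compact perturbation of \<open>0\<close>.

  Schauder's theorem needs Brouwer's theorem in every finite dimension.  Since the dimension here
  is a number found within the proof, it is obtained, for approximate fixed points of self-maps of
  the cube, directly from Kuhn's combinatorial lemma (\<open>approximate_fixed_point_cube\<close>).
\<close>

section \<open>Approximate fixed points in the cube\<close>

text \<open>
  Approximate form of Brouwer's theorem for the cube \<open>[0,1]\<^sup>n\<close>.  A point of the cube is a
  function on the naturals of which only the values below \<open>n\<close> matter; uniform continuity is
  with respect to the maximum norm of these coordinates.
\<close>
lemma approximate_fixed_point_cube:
  fixes F :: "(nat \<Rightarrow> real) \<Rightarrow> nat \<Rightarrow> real"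
  assumes range: "\<And>x i. \<forall>i<n. 0 \<le> x i \<and> x i \<le> 1 \<Longrightarrow> i < n \<Longrightarrow> 0 \<le> F x i \<and> F x i \<le> 1"
    and ucont: "\<And>e. 0 < e \<Longrightarrow> \<exists>d>0. \<forall>x y. (\<forall>i<n. 0 \<le> x i \<and> x i \<le> 1) \<longrightarrow>
        (\<forall>i<n. 0 \<le> y i \<and> y i \<le> 1) \<longrightarrow> (\<forall>i<n. \<bar>x i - y i\<bar> < d) \<longrightarrow>
        (\<forall>i<n. \<bar>F x i - F y i\<bar> < e)"
    and "0 < e"
  obtains x where "\<forall>i<n. 0 \<le> x i \<and> x i \<le> 1" "\<forall>i<n. \<bar>F x i - x i\<bar> < e"
proof -
  obtain d where d: "0 < d" and dF: "\<And>x y i. \<lbrakk>\<forall>i<n. 0 \<le> x i \<and> x i \<le> 1;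
      \<forall>i<n. 0 \<le> y i \<and> y i \<le> 1; \<forall>i<n. \<bar>x i - y i\<bar> < d; i < n\<rbrakk> \<Longrightarrow> \<bar>F x i - F y i\<bar> < e/2"
    using ucont[of "e/2"] \<open>0 < e\<close> by (metis half_gt_zero)
  obtain p :: nat where p: "0 < p" "1 / real p < min d (e/2)"
    using reals_Archimedean[of "min d (e/2)"] d \<open>0 < e\<close>
    by (metis half_gt_zero inverse_eq_divide min_less_iff_conj zero_less_Suc)
  define pt where "pt q = (\<lambda>i. real (q i) / real p)" for q :: "nat \<Rightarrow> nat"
  \<comment> \<open>The label of a grid point records the direction in which \<open>F\<close> moves each coordinate; on
     the faces of the cube it takes the values that Kuhn's lemma demands.\<close>
  define label :: "(nat \<Rightarrow> nat) \<Rightarrow> nat \<Rightarrow> nat" where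
    "label q i = (if q i = 0 then 0 else if q i = p then 1 else
        if pt q i \<le> F (pt q) i then 0 else 1)" for q i
  have cube: "\<forall>i<n. 0 \<le> pt q i \<and> pt q i \<le> 1" if "\<forall>i<n. q i \<le> p" for q
    using that p(1) by (auto simp: pt_def divide_simps)
  have label0: "pt q i \<le> F (pt q) i" if "label q i = 0" "\<forall>i<n. q i \<le> p" "i < n" for q i
    using range[OF cube[OF that(2)] that(3)] that p(1)
    by (auto simp: label_def pt_def split: if_splits)
  have label1: "F (pt q) i \<le> pt q i" if "label q i = 1" "\<forall>i<n. q i \<le> p" "i < n" for q i
    using range[OF cube[OF that(2)] that(3)] that p(1)
    by (auto simp: label_def pt_def split: if_splits)
  obtain q where q: "\<forall>i<n. q i < p"
    and rs: "\<forall>i<n. \<exists>r s. (\<forall>j<n. q j \<le> r j \<and> r j \<le> q j + 1) \<and>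
        (\<forall>j<n. q j \<le> s j \<and> s j \<le> q j + 1) \<and> label r i \<noteq> label s i"
    by (rule kuhn_lemma[of p n label]) (use p(1) in \<open>auto simp: label_def\<close>)
  have qp: "\<forall>i<n. q i \<le> p" using q by (simp add: less_imp_le)
  \<comment> \<open>In the small cube with lower corner \<open>q\<close>, both \<open>F\<close> and the points vary by less than \<open>e/2\<close>.\<close>
  have near: "\<bar>F (pt r) i - F (pt q) i\<bar> < e/2 \<and> pt q i \<le> pt r i \<and> pt r i < pt q i + e/2 \<and>
      (\<forall>i<n. r i \<le> p)"
    if r: "\<forall>j<n. q j \<le> r j \<and> r j \<le> q j + 1" and i: "i < n" for r i
  proof -
    have rp: "\<forall>i<n. r i \<le> p" using r q by fastforce
    have diff: "pt q j \<le> pt r j \<and> pt r j \<le> pt q j + 1 / p" if "j < n" for j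
      using r that p(1) by (auto simp: pt_def divide_simps)
    have "\<forall>j<n. \<bar>pt r j - pt q j\<bar> < d"
      using diff p(2) by (smt (verit) min_less_iff_conj)
    from dF[OF cube[OF rp] cube[OF qp] this i] diff[OF i] p(2) rp show ?thesis by auto
  qed
  have "\<bar>F (pt q) i - pt q i\<bar> < e" if i: "i < n" for i
  proof -
    obtain r s where r: "\<forall>j<n. q j \<le> r j \<and> r j \<le> q j + 1"
      and s: "\<forall>j<n. q j \<le> s j \<and> s j \<le> q j + 1" and "label r i \<noteq> label s i"
      using rs i by blast
    moreover have "label r i \<in> {0,1}" "label s i \<in> {0,1}" by (auto simp: label_def)
    ultimately consider "label r i = 0" "label s i = 1" | "label r i = 1" "label s i = 0"
      by auto
    then show ?thesis
    proof cases
      case 1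
      then show ?thesis
        using near[OF r i] near[OF s i] label0[of r, OF _ _ i] label1[of s, OF _ _ i] by simp argo
    next
      case 2
      then show ?thesis
        using near[OF r i] near[OF s i] label1[of r, OF _ _ i] label0[of s, OF _ _ i] by simp argo
    qed
  qed
  then show thesis using that[of "pt q"] cube[OF qp] by blast
qed

section \<open>Schauder's fixed point theorem\<close>

lemma norm_convex_combination_diff_le:
  fixes z :: "'i \<Rightarrow> 'a::real_normed_vector"
  assumes "\<And>i. i \<in> I \<Longrightarrow> 0 \<le> w i" and "sum w I = 1"
    and "\<And>i. i \<in> I \<Longrightarrow> w i \<noteq> 0 \<Longrightarrow> norm (z i - y) \<le> e"
  shows "norm ((\<Sum>i\<in>I. w i *\<^sub>R z i) - y) \<le> e"
proof -
  have "(\<Sum>i\<in>I. w i *\<^sub>R z i) - y = (\<Sum>i\<in>I. w i *\<^sub>R z i) - (\<Sum>i\<in>I. w i) *\<^sub>R y"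
    using assms(2) by simp
  also have "\<dots> = (\<Sum>i\<in>I. w i *\<^sub>R (z i - y))"
    by (simp add: scaleR_diff_right sum_subtractf scaleR_left.sum)
  also have "norm \<dots> \<le> (\<Sum>i\<in>I. w i * e)"
  proof (rule sum_norm_le)
    fix i assume "i \<in> I"
    then show "norm (w i *\<^sub>R (z i - y)) \<le> w i * e"
      using assms(1,3) by (cases "w i = 0") (auto intro: mult_left_mono)
  qed
  also have "\<dots> = e" using assms(2) by (simp flip: sum_distrib_right)
  finally show ?thesis .
qed

text \<open>The linear image of the cube \<open>[0,1]\<^sup>n\<close> spanned by the vectors \<open>z\<^sub>0, \<dots>, z\<^sub>n\<^sub>-\<^sub>1\<close>.\<close>
lemma compact_cube_combinations:
  fixes z :: "nat \<Rightarrow> 'a::real_normed_vector"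
  shows "compact {\<Sum>i<n. c i *\<^sub>R z i |c. \<forall>i<n. 0 \<le> c i \<and> c i \<le> (1::real)}" (is "compact (?P n)")
proof (induction n)
  case 0
  then show ?case by simp
next
  case (Suc n)
  have "compact ((\<lambda>t. t *\<^sub>R z n) ` {0..1::real})"
    by (intro compact_continuous_image continuous_intros) simp
  from compact_sums[OF Suc this]
  have "compact {x + y |x y. x \<in> ?P n \<and> y \<in> (\<lambda>t. t *\<^sub>R z n) ` {0..1::real}}" .
  moreover have "{x + y |x y. x \<in> ?P n \<and> y \<in> (\<lambda>t. t *\<^sub>R z n) ` {0..1::real}} = ?P (Suc n)"
  proof (intro equalityI subsetI)
    fix v assume "v \<in> {x + y |x y. x \<in> ?P n \<and> y \<in> (\<lambda>t. t *\<^sub>R z n) ` {0..1::real}}"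
    then obtain c t where v: "v = (\<Sum>i<n. c i *\<^sub>R z i) + t *\<^sub>R z n"
      and c: "\<forall>i<n. 0 \<le> c i \<and> c i \<le> 1" and t: "0 \<le> t" "t \<le> 1" by auto
    have "v = (\<Sum>i<Suc n. (c(n := t)) i *\<^sub>R z i)" using v by simp
    moreover have "\<forall>i<Suc n. 0 \<le> (c(n := t)) i \<and> (c(n := t)) i \<le> 1"
      using c t by (auto simp: less_Suc_eq)
    ultimately show "v \<in> ?P (Suc n)" by blast
  next
    fix v assume "v \<in> ?P (Suc n)"
    then obtain c where v: "v = (\<Sum>i<n. c i *\<^sub>R z i) + c n *\<^sub>R z n"
      and c: "\<forall>i<Suc n. 0 \<le> c i \<and> c i \<le> 1" by auto
    have "(\<Sum>i<n. c i *\<^sub>R z i) \<in> ?P n" "c n *\<^sub>R z n \<in> (\<lambda>t. t *\<^sub>R z n) ` {0..1::real}"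
      using c by auto
    with v show "v \<in> {x + y |x y. x \<in> ?P n \<and> y \<in> (\<lambda>t. t *\<^sub>R z n) ` {0..1::real}}" by blast
  qed
  ultimately show ?case by simp
qed

text \<open>The denominator of the partitions of unity below does not vanish.\<close>
lemma sum_bump_pos:
  fixes f :: "'i \<Rightarrow> real"
  assumes "finite I" "j \<in> I" "f j < e"
  shows "0 < (\<Sum>i\<in>I. max 0 (e - f i))"
  using assms by (intro sum_pos2[of I j]) auto

text \<open>
  With an \<open>e/2\<close>-net \<open>z\<^sub>0, \<dots>, z\<^sub>n\<^sub>-\<^sub>1\<close> of \<open>K\<close> and a subordinate partition of unity \<open>w\<close>, the map
  sends coefficients \<open>c\<close> in the cube to the weights \<open>w\<close> at \<open>f (\<rho> (\<Sum> c\<^sub>i z\<^sub>i))\<close>.  The retraction \<open>\<rho>\<close>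
  is there because \<open>\<Sum> c\<^sub>i z\<^sub>i\<close> may lie outside \<open>S\<close> when the \<open>c\<^sub>i\<close> do not sum to \<open>1\<close>.
\<close>
lemma approximate_fixed_point_compact_range:
  fixes f :: "'a::real_normed_vector \<Rightarrow> 'a"
  assumes "convex S" "S retract_of UNIV" "continuous_on S f" "f ` S \<subseteq> K"
    and "compact K" "K \<subseteq> S" "0 < e"
  obtains x where "x \<in> S" "norm (f x - x) < e"
proof -
  obtain \<rho> where \<rho>: "continuous_on UNIV \<rho>" "range \<rho> \<subseteq> S" "\<And>x. x \<in> S \<Longrightarrow> \<rho> x = x"
    using \<open>S retract_of UNIV\<close> by (auto simp: retract_of_def retraction_def)
  have "K \<subseteq> (\<Union>x\<in>K. ball x (e/2))" using \<open>0 < e\<close> by force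
  then obtain Z where Z: "Z \<subseteq> K" "finite Z" "K \<subseteq> (\<Union>x\<in>Z. ball x (e/2))"
    using compactE_image[OF \<open>compact K\<close>, of K "\<lambda>x. ball x (e/2)"] by blast
  obtain z n where Zz: "Z = z ` {i::nat. i < n}"
    using finite_imp_nat_seg_image_inj_on[OF Z(2)] by auto
  define \<beta> where "\<beta> i y = max 0 (e/2 - norm (z i - y))" for i y
  define w where "w i y = \<beta> i y / (\<Sum>j<n. \<beta> j y)" for i y
  have pos: "0 < (\<Sum>j<n. \<beta> j y)" if "y \<in> K" for y
  proof -
    have "\<exists>j<n. y \<in> ball (z j) (e/2)" using that Z(3) unfolding Zz by blast
    then obtain j where "j < n" "norm (z j - y) < e/2" by (auto simp: dist_norm)
    then show ?thesis unfolding \<beta>_def by (intro sum_bump_pos) auto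
  qed
  have \<beta>0: "0 \<le> \<beta> i y" for i y by (simp add: \<beta>_def)
  have w0: "0 \<le> w i y" if "y \<in> K" for i y
    using pos[OF that] \<beta>0 by (simp add: w_def)
  have w_sum: "(\<Sum>i<n. w i y) = 1" if "y \<in> K" for y
    using pos[OF that] by (simp add: w_def flip: sum_divide_distrib)
  have w1: "w i y \<le> 1" if "y \<in> K" "i < n" for i y
    using member_le_sum[of i "{..<n}" "\<lambda>i. w i y"] w0 w_sum that by auto
  have "continuous_on K (\<beta> i)" for i unfolding \<beta>_def by (intro continuous_intros)
  then have w_cont: "continuous_on K (w i)" for i
    unfolding w_def
    by (intro continuous_on_divide continuous_on_sum ballI less_imp_neq[symmetric] pos)
  have close: "norm ((\<Sum>i<n. w i y *\<^sub>R z i) - y) \<le> e/2" if "y \<in> K" for y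
  proof (rule norm_convex_combination_diff_le)
    fix i assume "w i y \<noteq> 0"
    then have "\<beta> i y \<noteq> 0" by (auto simp: w_def)
    then show "norm (z i - y) \<le> e/2" by (auto simp: \<beta>_def max_def split: if_splits)
  qed (use w0 w_sum that in auto)
  define P where "P = {\<Sum>i<n. c i *\<^sub>R z i |c. \<forall>i<n. 0 \<le> c i \<and> c i \<le> (1::real)}"
  have "compact P" unfolding P_def by (rule compact_cube_combinations)
  define W where "W c = (\<Sum>i<n. c i *\<^sub>R z i)" for c
  have WP: "W c \<in> P" if "\<forall>i<n. 0 \<le> c i \<and> c i \<le> 1" for c
    using that by (auto simp: W_def P_def)
  \<comment> \<open>A Lipschitz constant of \<open>W\<close>; adding \<open>1\<close> makes it positive and the next estimate strict.\<close>
  define B where "B = (\<Sum>i<n. norm (z i)) + 1"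
  have "0 < B" unfolding B_def by (meson add_nonneg_pos norm_ge_zero sum_nonneg zero_less_one)
  have W_diff: "norm (W c - W c') < d" if "0 < d" "\<forall>i<n. \<bar>c i - c' i\<bar> < d / B" for c c' d
  proof -
    have "W c - W c' = (\<Sum>i<n. (c i - c' i) *\<^sub>R z i)"
      by (simp add: W_def sum_subtractf scaleR_diff_left)
    also have "norm \<dots> \<le> (\<Sum>i<n. (d / B) * norm (z i))"
    proof (rule sum_norm_le)
      fix i assume "i \<in> {..<n}"
      then have "\<bar>c i - c' i\<bar> \<le> d / B" using that(2) by (simp add: less_imp_le)
      then show "norm ((c i - c' i) *\<^sub>R z i) \<le> (d / B) * norm (z i)"
        unfolding norm_scaleR by (rule mult_right_mono) simp
    qed
    also have "\<dots> = (d / B) * (B - 1)" by (simp add: B_def sum_distrib_left)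
    also have "\<dots> < d" using \<open>0 < B\<close> \<open>0 < d\<close> by (simp add: field_simps)
    finally show ?thesis .
  qed
  define F where "F c i = w i (f (\<rho> (W c)))" for c i
  have \<rho>S: "\<rho> v \<in> S" for v using \<rho>(2) by blast
  have fK: "f (\<rho> v) \<in> K" for v using \<rho>S assms(4) by blast
  have f\<rho>: "continuous_on UNIV (\<lambda>v. f (\<rho> v))"
    by (rule continuous_on_compose2[OF assms(3) \<rho>(1)]) (use \<rho>S in auto)
  have wf_cont: "continuous_on P (\<lambda>v. w i (f (\<rho> v)))" for i
    by (rule continuous_on_compose2[OF w_cont continuous_on_subset[OF f\<rho>]]) (use fK in auto)
  have "uniformly_continuous_on P \<rho>"
    using continuous_on_subset[OF \<rho>(1) subset_UNIV] \<open>compact P\<close>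
    by (rule compact_uniformly_continuous)
  from this[unfolded uniformly_continuous_on_def, rule_format, OF half_gt_zero[OF \<open>0 < e\<close>]]
  obtain d where d: "0 < d"
    and d\<rho>: "\<And>u v. u \<in> P \<Longrightarrow> v \<in> P \<Longrightarrow> norm (u - v) < d \<Longrightarrow> norm (\<rho> u - \<rho> v) < e/2"
    unfolding dist_norm by auto
  have F_ucont: "\<exists>d>0. \<forall>x y. (\<forall>i<n. 0 \<le> x i \<and> x i \<le> 1) \<longrightarrow>
        (\<forall>i<n. 0 \<le> y i \<and> y i \<le> 1) \<longrightarrow> (\<forall>i<n. \<bar>x i - y i\<bar> < d) \<longrightarrow>
        (\<forall>i<n. \<bar>F x i - F y i\<bar> < a)" if "0 < a" for a
  proof -
    have "\<exists>d>0. \<forall>v\<in>P. \<forall>u\<in>P. norm (u - v) < d \<longrightarrow>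
        \<bar>w i (f (\<rho> u)) - w i (f (\<rho> v))\<bar> < a" for i
      using compact_uniformly_continuous[OF wf_cont[of i] \<open>compact P\<close>,
          unfolded uniformly_continuous_on_def dist_norm real_norm_def, THEN spec, THEN mp,
          OF \<open>0 < a\<close>] .
    then obtain D where D: "\<And>i. 0 < D i" and Dw: "\<And>i u v. u \<in> P \<Longrightarrow> v \<in> P \<Longrightarrow>
        norm (u - v) < D i \<Longrightarrow> \<bar>w i (f (\<rho> u)) - w i (f (\<rho> v))\<bar> < a"
      by metis
    define m where "m = Min (insert 1 (D ` {..<n}))"
    have m: "0 < m" "\<And>i. i < n \<Longrightarrow> m \<le> D i"
      using D by (auto simp: m_def)
    show ?thesis
    proof (intro exI conjI allI impI)
      show "0 < m / B" using m \<open>0 < B\<close> by simp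
      fix x y i
      assume x: "\<forall>i<n. 0 \<le> x i \<and> x i \<le> 1" and y: "\<forall>i<n. 0 \<le> y i \<and> y i \<le> 1"
        and xy: "\<forall>i<n. \<bar>x i - y i\<bar> < m / B" and "i < n"
      have "norm (W x - W y) < D i"
        using W_diff[OF m(1) xy] m(2)[OF \<open>i < n\<close>] by simp
      then show "\<bar>F x i - F y i\<bar> < a"
        unfolding F_def by (rule Dw[OF WP[OF x] WP[OF y]])
    qed
  qed
  obtain c where c: "\<forall>i<n. 0 \<le> c i \<and> c i \<le> 1" and cF: "\<forall>i<n. \<bar>F c i - c i\<bar> < d / B"
  proof (rule approximate_fixed_point_cube[of n F "d / B"])
    show "0 < d / B" using d \<open>0 < B\<close> by simp
    show "0 \<le> F x i \<and> F x i \<le> 1" if "i < n" for x i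
      using w0[OF fK] w1[OF fK that] by (simp add: F_def)
  qed (rule F_ucont)
  define x where "x = \<rho> (W c)"
  have Fc: "\<forall>i<n. 0 \<le> F c i \<and> F c i \<le> 1" using w0[OF fK] w1[OF fK] by (auto simp: F_def)
  \<comment> \<open>\<open>W (F c)\<close> is a true convex combination, so \<open>\<rho>\<close> fixes it, and it is near both \<open>x\<close> and \<open>f x\<close>.\<close>
  have "W (F c) \<in> S"
    unfolding W_def
  proof (rule convex_sum)
    show "(\<Sum>i<n. F c i) = 1" unfolding F_def by (rule w_sum[OF fK])
    show "z i \<in> S" if "i \<in> {..<n}" for i using that Z(1) assms(6) unfolding Zz by blast
    show "0 \<le> F c i" for i unfolding F_def by (rule w0[OF fK])
  qed (use \<open>convex S\<close> in auto)
  then have "norm (W (F c) - x) < e/2"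
    using d\<rho>[OF WP[OF Fc] WP[OF c] W_diff[OF d cF]] \<rho>(3) by (simp add: x_def)
  moreover have "norm (W (F c) - f x) \<le> e/2"
    using close[OF fK] by (simp add: W_def F_def x_def)
  ultimately have "norm (f x - x) < e"
    using norm_triangle_ineq4[of "W (F c) - x" "W (F c) - f x"] by simp
  then show thesis using that \<rho>S by (auto simp: x_def)
qed

text \<open>
  Schauder's theorem for convex sets that are retracts of the whole space, which includes the
  closed balls.  No completeness is needed, because the range of \<open>f\<close> lies in a compact set.
\<close>
theorem schauder_fixed_point:
  fixes f :: "'a::real_normed_vector \<Rightarrow> 'a"
  assumes "convex S" "S retract_of UNIV" "continuous_on S f" "f ` S \<subseteq> K"
    and "compact K" "K \<subseteq> S"
  obtains x where "x \<in> S" "f x = x"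
proof -
  have "\<exists>x. x \<in> S \<and> norm (f x - x) < inverse (real (Suc n))" for n
    by (rule approximate_fixed_point_compact_range[OF assms, of "inverse (real (Suc n))"]) auto
  then obtain x where xS: "\<And>n. x n \<in> S"
    and x: "\<And>n. norm (f (x n) - x n) < inverse (real (Suc n))" by metis
  have "\<forall>n. f (x n) \<in> K" using assms(4) xS by blast
  then obtain y r where y: "y \<in> K" "strict_mono r" "(\<lambda>n. f (x (r n))) \<longlonglongrightarrow> y"
    by (rule seq_compactE[OF compact_imp_seq_compact[OF \<open>compact K\<close>], of "\<lambda>n. f (x n)"])
      (auto simp: o_def)
  have "(\<lambda>n. f (x n) - x n) \<longlonglongrightarrow> 0"
    by (rule Lim_null_comparison[OF _ LIMSEQ_inverse_real_of_nat])
      (intro always_eventually allI less_imp_le[OF x])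
  from LIMSEQ_subseq_LIMSEQ[OF this y(2)]
  have "(\<lambda>n. f (x (r n)) - (f (x (r n)) - x (r n))) \<longlonglongrightarrow> y - 0"
    by (intro tendsto_diff y(3)) (simp add: o_def)
  then have "(\<lambda>n. x (r n)) \<longlonglongrightarrow> y" by simp
  then have "(\<lambda>n. f (x (r n))) \<longlonglongrightarrow> f y"
    by (rule continuous_on_tendsto_compose[OF assms(3)]) (use xS y(1) assms(6) in auto)
  then have "f y = y" using y(3) by (rule LIMSEQ_unique)
  with y(1) assms(6) that show thesis by blast
qed

lemma cball_retract_of_UNIV:
  fixes a :: "'a::real_normed_vector"
  assumes "0 < r"
  shows "cball a r retract_of UNIV"
proof -
  \<comment> \<open>The radial retraction.\<close>
  define \<rho> where "\<rho> x = a + (r / max r (norm (x - a))) *\<^sub>R (x - a)" for x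
  have "continuous_on UNIV \<rho>"
    unfolding \<rho>_def by (intro continuous_intros) (use assms in auto)
  moreover have "\<rho> x \<in> cball a r" for x
    using assms by (auto simp: \<rho>_def dist_norm max_def)
  moreover have "\<rho> x = x" if "x \<in> cball a r" for x
    using that assms by (simp add: \<rho>_def dist_norm norm_minus_commute)
  ultimately show ?thesis
    unfolding retract_of_def retraction_def by blast
qed

section \<open>Compact operators\<close>

lemma compact_operatorI:
  assumes "bounded_linear T" "T ` cball 0 1 \<subseteq> C" "compact C"
  shows "compact_operator T"
proof -
  have "closure (T ` cball 0 1) \<subseteq> C"
    using assms(2,3) by (simp add: closure_minimal compact_imp_closed)
  then have "compact (closure (T ` cball 0 1))"
    using assms(3) by (metis closed_closure compact_Int_closed inf.absorb2)
  with assms(1) show ?thesis by (simp add: compact_operator_def)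
qed

lemma compact_operator_cball:
  assumes "compact_operator T"
  obtains C where "compact C" "T ` cball a r \<subseteq> C"
proof
  have lin: "bounded_linear T" and cpt: "compact (closure (T ` cball 0 1))"
    using assms by (auto simp: compact_operator_def)
  interpret T: bounded_linear T by fact
  define R where "R = max r 1"
  have "0 < R" by (simp add: R_def)
  let ?g = "\<lambda>y. T a + R *\<^sub>R y"
  show "compact (?g ` closure (T ` cball 0 1))"
    by (intro compact_continuous_image continuous_intros cpt)
  show "T ` cball a r \<subseteq> ?g ` closure (T ` cball 0 1)"
  proof safe
    fix x assume "x \<in> cball a r"
    then have "norm (x - a) \<le> R" by (simp add: dist_norm norm_minus_commute R_def)
    then have "inverse R *\<^sub>R (x - a) \<in> cball 0 1"
      using \<open>0 < R\<close> by (simp add: divide_simps)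
    moreover have "T x = ?g (T (inverse R *\<^sub>R (x - a)))"
      using \<open>0 < R\<close> by (simp add: T.scaleR T.diff)
    ultimately show "T x \<in> ?g ` closure (T ` cball 0 1)"
      using closure_subset[of "T ` cball 0 1"] by blast
  qed
qed

lemma compact_operator_add:
  assumes "compact_operator A" "compact_operator B"
  shows "compact_operator (\<lambda>x. A x + B x)"
proof -
  obtain C where C: "compact C" "A ` cball 0 1 \<subseteq> C" by (rule compact_operator_cball[OF assms(1)])
  obtain D where D: "compact D" "B ` cball 0 1 \<subseteq> D" by (rule compact_operator_cball[OF assms(2)])
  show ?thesis
  proof (rule compact_operatorI)
    show "bounded_linear (\<lambda>x. A x + B x)"
      using assms by (auto simp: compact_operator_def intro: bounded_linear_add)
    show "(\<lambda>x. A x + B x) ` cball 0 1 \<subseteq> {x + y |x y. x \<in> C \<and> y \<in> D}" using C(2) D(2) by blast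
    show "compact {x + y |x y. x \<in> C \<and> y \<in> D}" using C(1) D(1) by (rule compact_sums)
  qed
qed

lemma compact_operator_compose_left:
  assumes "bounded_linear A" "compact_operator B"
  shows "compact_operator (\<lambda>x. A (B x))"
proof -
  obtain C where C: "compact C" "B ` cball 0 1 \<subseteq> C" by (rule compact_operator_cball[OF assms(2)])
  show ?thesis
  proof (rule compact_operatorI)
    show "bounded_linear (\<lambda>x. A (B x))"
      using assms by (auto simp: compact_operator_def intro: bounded_linear_compose)
    show "(\<lambda>x. A (B x)) ` cball 0 1 \<subseteq> A ` C" using C(2) by blast
    show "compact (A ` C)"
      by (intro compact_continuous_image linear_continuous_on assms C)
  qed
qed

lemma compact_operator_compose_right:
  assumes "compact_operator A" "bounded_linear B"
  shows "compact_operator (\<lambda>x. A (B x))"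
proof -
  obtain b where b: "\<And>x. norm (B x) \<le> norm x * b" "0 < b"
    using bounded_linear.pos_bounded[OF assms(2)] by blast
  obtain C where C: "compact C" "A ` cball 0 b \<subseteq> C" by (rule compact_operator_cball[OF assms(1)])
  have B_ball: "B x \<in> cball 0 b" if "x \<in> cball 0 1" for x
    using that b(1)[of x] b(2) mult_right_mono[of "norm x" 1 b] by (auto intro: order_trans)
  show ?thesis
  proof (rule compact_operatorI[OF _ _ C(1)])
    show "bounded_linear (\<lambda>x. A (B x))"
      using assms by (auto simp: compact_operator_def intro: bounded_linear_compose)
    show "(\<lambda>x. A (B x)) ` cball 0 1 \<subseteq> C" using C(2) B_ball by blast
  qed
qed

lemma compact_operator_zero: "compact_operator (\<lambda>x. 0)"
  by (rule compact_operatorI[of _ "{0}"]) auto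

lemma bounded_linear_funpow:
  fixes T :: "'a::real_normed_vector \<Rightarrow> 'a"
  assumes "bounded_linear T"
  shows "bounded_linear (T ^^ n)"
proof (induction n)
  case 0
  then show ?case by (simp add: bounded_linear_ident id_def)
next
  case (Suc n)
  then show ?case using bounded_linear_compose[OF assms] by (simp add: o_def)
qed

lemma funpow_compact_perturbation:
  fixes Q K :: "'a::real_normed_vector \<Rightarrow> 'a"
  assumes "bounded_linear Q" "compact_operator K"
  shows "\<exists>C. compact_operator C \<and> ((\<lambda>x. Q x + K x) ^^ n) = (\<lambda>x. (Q ^^ n) x + C x)"
proof (induction n)
  case 0
  show ?case by (intro exI[of _ "\<lambda>x. 0"]) (auto simp: compact_operator_zero)
next
  case (Suc n)
  let ?D = "\<lambda>x. Q x + K x"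
  obtain C where C: "compact_operator C" "(?D ^^ n) = (\<lambda>x. (Q ^^ n) x + C x)"
    using Suc by blast
  have D: "bounded_linear ?D"
    using assms by (auto simp: compact_operator_def intro: bounded_linear_add)
  have "compact_operator (\<lambda>x. Q (C x) + K ((?D ^^ n) x))"
    by (intro compact_operator_add compact_operator_compose_left[OF assms(1) C(1)]
        compact_operator_compose_right[OF assms(2)] bounded_linear_funpow[OF D])
  moreover have "(?D ^^ Suc n) = (\<lambda>x. (Q ^^ Suc n) x + (Q (C x) + K ((?D ^^ n) x)))"
    by (rule ext) (simp add: C(2) linear_add[OF bounded_linear.linear[OF assms(1)]])
  ultimately show ?case by blast
qed

section \<open>Lomonosov's theorem\<close>

text \<open>
  \<open>Y\<close> is a closed subspace invariant under \<open>T\<close>, neither zero nor the whole space.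
\<close>
definition nontrivial_invariant_subspace ::
    "('a::real_normed_vector \<Rightarrow> 'a) \<Rightarrow> 'a set \<Rightarrow> bool" where
  "nontrivial_invariant_subspace T Y \<longleftrightarrow>
     subspace Y \<and> closed Y \<and> Y \<noteq> {0} \<and> Y \<noteq> UNIV \<and> T ` Y \<subseteq> Y"

text \<open>The bounded linear operators that commute with \<open>D\<close>.\<close>
definition commutant :: "('a::real_normed_vector \<Rightarrow> 'a) \<Rightarrow> ('a \<Rightarrow> 'a) set" where
  "commutant D = {A. bounded_linear A \<and> (\<forall>x. A (D x) = D (A x))}"

lemma commutant_sum_scaleR:
  assumes "bounded_linear D" "\<And>i. i \<in> I \<Longrightarrow> p i \<in> commutant D"
  shows "(\<lambda>x. \<Sum>i\<in>I. c i *\<^sub>R p i x) \<in> commutant D"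
proof -
  interpret D: bounded_linear D by fact
  have "bounded_linear (\<lambda>x. \<Sum>i\<in>I. c i *\<^sub>R p i x)"
    using assms(2)
    by (auto simp: commutant_def intro!: bounded_linear_sum bounded_linear_const_scaleR)
  then show ?thesis
    using assms(2) by (auto simp: commutant_def D.sum D.scaleR intro!: sum.cong)
qed

lemma subspace_closure:
  fixes V :: "'a::real_normed_vector set"
  assumes "subspace V"
  shows "subspace (closure V)"
proof (rule subspaceI)
  show "0 \<in> closure V" using subspace_0[OF assms] closure_subset by blast
next
  fix x y assume "x \<in> closure V" "y \<in> closure V"
  then obtain f g where "\<forall>n. f n \<in> V" "f \<longlonglongrightarrow> x" "\<forall>n. g n \<in> V" "g \<longlonglongrightarrow> y"
    unfolding closure_sequential by blast
  then have "\<forall>n. f n + g n \<in> V" "(\<lambda>n. f n + g n) \<longlonglongrightarrow> x + y"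
    using assms by (auto intro: subspace_add tendsto_add)
  then show "x + y \<in> closure V"
    unfolding closure_sequential by (intro exI[of _ "\<lambda>n. f n + g n"] conjI)
next
  fix c x assume "x \<in> closure V"
  then obtain f where "\<forall>n. f n \<in> V" "f \<longlonglongrightarrow> x"
    unfolding closure_sequential by blast
  then have "\<forall>n. c *\<^sub>R f n \<in> V" "(\<lambda>n. c *\<^sub>R f n) \<longlonglongrightarrow> c *\<^sub>R x"
    using assms by (auto intro: subspace_scale tendsto_intros)
  then show "c *\<^sub>R x \<in> closure V"
    unfolding closure_sequential by (intro exI[of _ "\<lambda>n. c *\<^sub>R f n"] conjI)
qed

text \<open>The closure of the orbit of \<open>y\<close> is a closed subspace invariant under \<open>D\<close> and contains \<open>y\<close>.\<close>
lemma commutant_orbit_dense: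
  fixes D :: "'a::real_normed_vector \<Rightarrow> 'a"
  assumes D: "bounded_linear D" and none: "\<nexists>Y. nontrivial_invariant_subspace D Y" and "y \<noteq> 0"
  shows "closure ((\<lambda>A. A y) ` commutant D) = UNIV"
proof -
  interpret D: bounded_linear D by fact
  let ?V = "((\<lambda>A. A y) ` commutant D)"
  have V: "A y \<in> ?V" if "A \<in> commutant D" for A using that by blast
  have "(\<lambda>x. 0) \<in> commutant D" "(\<lambda>x. x) \<in> commutant D"
    by (auto simp: commutant_def D.zero bounded_linear_ident)
  then have "0 \<in> ?V" "y \<in> ?V" using V[of "\<lambda>x. 0"] V[of "\<lambda>x. x"] by simp_all
  moreover have "u + v \<in> ?V" if uv: "u \<in> ?V" "v \<in> ?V" for u v
  proof -
    obtain A where "u = A y" and A: "A \<in> commutant D" using uv(1) by (rule imageE)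
    moreover obtain B where "v = B y" and B: "B \<in> commutant D" using uv(2) by (rule imageE)
    moreover have "(\<lambda>x. A x + B x) \<in> commutant D"
      using A B by (auto simp: commutant_def D.add intro: bounded_linear_add)
    ultimately show ?thesis using V[of "\<lambda>x. A x + B x"] by simp
  qed
  moreover have "c *\<^sub>R v \<in> ?V" if v: "v \<in> ?V" for c v
  proof -
    obtain B where "v = B y" and B: "B \<in> commutant D" using v by (rule imageE)
    moreover have "(\<lambda>x. c *\<^sub>R B x) \<in> commutant D"
      using B by (auto simp: commutant_def D.scaleR intro: bounded_linear_const_scaleR)
    ultimately show ?thesis using V[of "\<lambda>x. c *\<^sub>R B x"] by simp
  qed
  ultimately have "subspace ?V" by (simp only: subspace_def) blast
  then have "subspace (closure ?V)" by (rule subspace_closure)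
  moreover have "D ` closure ?V \<subseteq> closure ?V"
  proof -
    have "D v \<in> ?V" if v: "v \<in> ?V" for v
    proof -
      obtain B where "v = B y" and B: "B \<in> commutant D" using v by (rule imageE)
      moreover have "(\<lambda>x. D (B x)) \<in> commutant D"
        using B by (auto simp: commutant_def intro: bounded_linear_compose[OF D])
      ultimately show ?thesis using V[of "\<lambda>x. D (B x)"] by simp
    qed
    then have "D ` ?V \<subseteq> closure ?V" using closure_subset by blast
    then show ?thesis
      by (intro image_closure_subset linear_continuous_on[OF D]) auto
  qed
  moreover have "closure ?V \<noteq> {0}"
    using subsetD[OF closure_subset \<open>y \<in> ?V\<close>] \<open>y \<noteq> 0\<close> by auto
  ultimately show ?thesis
    using none closed_closure unfolding nontrivial_invariant_subspace_def by blast
qed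

text \<open>
  The core of Lomonosov's argument.  The operator \<open>A\<close> is a convex combination of finitely many
  elements of the commutant, whose coefficients depend on the fixed point \<open>x\<close> of a nonlinear map.
\<close>
lemma lomonosov_fixed_vector:
  fixes D M :: "'a::real_normed_vector \<Rightarrow> 'a"
  assumes D: "bounded_linear D" and M: "compact_operator M" and "M \<noteq> (\<lambda>x. 0)"
    and none: "\<nexists>Y. nontrivial_invariant_subspace D Y"
  shows "\<exists>A\<in>commutant D. \<exists>x. x \<noteq> 0 \<and> A (M x) = x"
proof -
  interpret M: bounded_linear M using M by (simp add: compact_operator_def)
  obtain x\<^sub>0 where x0: "M x\<^sub>0 \<noteq> 0" using \<open>M \<noteq> (\<lambda>x. 0)\<close> by blast
  obtain b where b: "0 < b" "\<And>x. norm (M x) \<le> norm x * b" using M.pos_bounded by blast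
  \<comment> \<open>Small enough that \<open>norm (M x)\<close> is at least \<open>norm (M x\<^sub>0) / 2\<close> on the ball of radius \<open>r\<close>.\<close>
  define r where "r = norm (M x\<^sub>0) / (2 * b)"
  have "0 < r" using x0 b by (simp add: r_def)
  define U :: "'a set" where "U = {y. norm (M x\<^sub>0) / 2 \<le> norm y}"
  have "closed U" unfolding U_def by (intro closed_Collect_le continuous_intros)
  have MU: "M x \<in> U" if "x \<in> cball x\<^sub>0 r" for x
  proof -
    have "norm (x\<^sub>0 - x) \<le> r" using that by (simp add: dist_norm)
    then have "norm (x\<^sub>0 - x) * b \<le> norm (M x\<^sub>0) / 2"
      using b(1) by (simp add: r_def field_simps)
    then have "norm (M x\<^sub>0 - M x) \<le> norm (M x\<^sub>0) / 2"
      using b(2)[of "x\<^sub>0 - x"] by (simp add: M.diff)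
    then show ?thesis
      unfolding U_def using norm_triangle_ineq2[of "M x\<^sub>0" "M x"] by simp
  qed
  obtain C' where C': "compact C'" "M ` cball x\<^sub>0 r \<subseteq> C'" by (rule compact_operator_cball[OF M])
  define C where "C = C' \<inter> U"
  have "compact C" unfolding C_def by (intro compact_Int_closed C' \<open>closed U\<close>)
  have MC: "M ` cball x\<^sub>0 r \<subseteq> C" using C'(2) MU by (auto simp: C_def)
  have C_nz: "y \<noteq> 0" if "y \<in> C" for y using that x0 by (auto simp: C_def U_def)
  have cont: "continuous_on UNIV A" if "A \<in> commutant D" for A
    using that by (auto simp: commutant_def intro: linear_continuous_on)
  have "C \<subseteq> (\<Union>A\<in>commutant D. A -` ball x\<^sub>0 r)"
  proof
    fix y assume "y \<in> C"
    then have "x\<^sub>0 \<in> closure ((\<lambda>A. A y) ` commutant D)"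
      using commutant_orbit_dense[OF D none C_nz] by auto
    then obtain A where "A \<in> commutant D" "dist (A y) x\<^sub>0 < r"
      unfolding closure_approachable using \<open>0 < r\<close> by blast
    then show "y \<in> (\<Union>A\<in>commutant D. A -` ball x\<^sub>0 r)" by (auto simp: dist_commute)
  qed
  then obtain I where I: "I \<subseteq> commutant D" "finite I" "C \<subseteq> (\<Union>A\<in>I. A -` ball x\<^sub>0 r)"
    using compactE_image[OF \<open>compact C\<close>, of "commutant D" "\<lambda>A. A -` ball x\<^sub>0 r"] cont
    by (metis open_ball open_vimage)
  define \<alpha> :: "('a \<Rightarrow> 'a) \<Rightarrow> 'a \<Rightarrow> real" where "\<alpha> A y = max 0 (r - norm (A y - x\<^sub>0))" for A y
  define w where "w A y = \<alpha> A y / (\<Sum>B\<in>I. \<alpha> B y)" for A y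
  have pos: "0 < (\<Sum>A\<in>I. \<alpha> A y)" if y: "y \<in> C" for y
  proof -
    obtain A where "A \<in> I" "A y \<in> ball x\<^sub>0 r" using y I(3) by blast
    then have "norm (A y - x\<^sub>0) < r" by (simp add: dist_norm norm_minus_commute)
    with \<open>A \<in> I\<close> show ?thesis unfolding \<alpha>_def by (intro sum_bump_pos[OF I(2)])
  qed
  define \<Phi> where "\<Phi> y = (\<Sum>A\<in>I. w A y *\<^sub>R A y)" for y
  have cont_C: "continuous_on C A" if "A \<in> I" for A
    using that I(1) by (intro continuous_on_subset[OF cont]) auto
  then have "continuous_on C (\<alpha> A)" if "A \<in> I" for A
    unfolding \<alpha>_def using that by (intro continuous_intros)
  then have "continuous_on C \<Phi>"
    unfolding \<Phi>_def w_def
    by (intro continuous_on_sum continuous_on_scaleR continuous_on_divide cont_C ballI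
        less_imp_neq[symmetric] pos)
  have \<Phi>_ball: "\<Phi> y \<in> cball x\<^sub>0 r" if "y \<in> C" for y
  proof -
    have "norm (\<Phi> y - x\<^sub>0) \<le> r"
      unfolding \<Phi>_def
    proof (rule norm_convex_combination_diff_le)
      show "(\<Sum>A\<in>I. w A y) = 1" using pos[OF that] by (simp add: w_def flip: sum_divide_distrib)
      fix A
      show "0 \<le> w A y" using pos[OF that] by (simp add: w_def \<alpha>_def)
      assume "w A y \<noteq> 0"
      then have "\<alpha> A y \<noteq> 0" by (auto simp: w_def)
      then show "norm (A y - x\<^sub>0) \<le> r" by (auto simp: \<alpha>_def max_def split: if_splits)
    qed
    then show ?thesis by (simp add: dist_norm norm_minus_commute)
  qed
  obtain x where x: "x \<in> cball x\<^sub>0 r" "\<Phi> (M x) = x"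
  proof (rule schauder_fixed_point)
    show "continuous_on (cball x\<^sub>0 r) (\<lambda>x. \<Phi> (M x))"
      by (rule continuous_on_compose2[OF \<open>continuous_on C \<Phi>\<close> _ MC])
        (rule linear_continuous_on[OF M.bounded_linear_axioms])
    show "compact (\<Phi> ` C)" by (intro compact_continuous_image \<open>continuous_on C \<Phi>\<close> \<open>compact C\<close>)
    show "(\<lambda>x. \<Phi> (M x)) ` cball x\<^sub>0 r \<subseteq> \<Phi> ` C" using MC by blast
    show "\<Phi> ` C \<subseteq> cball x\<^sub>0 r" using \<Phi>_ball by blast
  qed (auto intro: cball_retract_of_UNIV[OF \<open>0 < r\<close>])
  show ?thesis
  proof (intro bexI exI conjI)
    show "(\<lambda>v. \<Sum>A\<in>I. w A (M x) *\<^sub>R A v) \<in> commutant D"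
      by (rule commutant_sum_scaleR[OF D]) (use I(1) in auto)
    show "(\<Sum>A\<in>I. w A (M x) *\<^sub>R A (M x)) = x" using x(2) by (simp add: \<Phi>_def)
    show "x \<noteq> 0" using C_nz MC x(1) M.zero by blast
  qed
qed

text \<open>
  Over the reals the invariant subspace is found for \<open>D\<close> itself: it need not be invariant under
  the whole commutant.  Non-compactness of the identity expresses infinite dimension.
\<close>
theorem lomonosov:
  fixes D M :: "'a::real_normed_vector \<Rightarrow> 'a"
  assumes D: "bounded_linear D" and M: "compact_operator M" "M \<noteq> (\<lambda>x. 0)"
    and comm: "\<And>x. M (D x) = D (M x)"
    and "\<not> compact_operator (\<lambda>x::'a. x)"
  shows "\<exists>Y. nontrivial_invariant_subspace D Y"
proof (rule ccontr)
  assume none: "\<nexists>Y. nontrivial_invariant_subspace D Y"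
  obtain A x where A: "A \<in> commutant D" and x: "A (M x) = x" "x \<noteq> 0"
    using lomonosov_fixed_vector[OF D M none] by blast
  have AM: "compact_operator (\<lambda>x. A (M x))"
    by (rule compact_operator_compose_left[OF _ M(1)]) (use A in \<open>simp add: commutant_def\<close>)
  then interpret AM: bounded_linear "\<lambda>x. A (M x)" by (simp add: compact_operator_def)
  let ?E = "{v. A (M v) = v}"
  have "subspace ?E" by (simp add: subspace_def AM.add AM.scaleR AM.zero)
  moreover have "closed ?E"
    by (intro closed_Collect_eq linear_continuous_on AM.bounded_linear_axioms continuous_on_id)
  moreover have "?E \<noteq> {0}" using x by blast
  moreover have "D ` ?E \<subseteq> ?E" using A comm by (auto simp: commutant_def)
  moreover have "?E \<noteq> UNIV"
  proof
    assume "?E = UNIV"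
    then have "(\<lambda>x. A (M x)) = (\<lambda>x. x)" by blast
    with AM assms(5) show False by simp
  qed
  ultimately show False using none unfolding nontrivial_invariant_subspace_def by blast
qed

section \<open>Nilpotent and power-compact operators\<close>

lemma nilpotent_kernel_nontrivial:
  fixes N :: "'a::real_normed_vector \<Rightarrow> 'a"
  assumes N: "bounded_linear N" "N \<noteq> (\<lambda>x. 0)" "N ^^ n = (\<lambda>x. 0)"
  shows "nontrivial_invariant_subspace N {x. N x = 0}"
proof -
  interpret N: bounded_linear N by fact
  have "{x. N x = 0} \<noteq> {0}"
  proof
    assume ker: "{x. N x = 0} = {0}"
    have inj: "(N ^^ m) x = 0 \<Longrightarrow> x = 0" for m x
      by (induction m) (use ker in auto)
    obtain x where "N x \<noteq> 0" using N(2) by blast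
    then show False using inj[of n x] N(3) N.zero by auto
  qed
  moreover have "closed {x. N x = 0}"
    by (intro closed_Collect_eq linear_continuous_on N.bounded_linear_axioms continuous_on_const)
  moreover have "{x. N x = 0} \<noteq> UNIV" using N(2) by blast
  ultimately show ?thesis
    by (auto simp: nontrivial_invariant_subspace_def subspace_def N.add N.scaleR N.zero)
qed

text \<open>Adding a scalar multiple of the identity preserves invariant subspaces.\<close>
lemma nontrivial_invariant_subspace_shift:
  assumes "nontrivial_invariant_subspace D Y" "\<And>x. T x = c *\<^sub>R x + D x"
  shows "nontrivial_invariant_subspace T Y"
  using assms
  by (auto simp: nontrivial_invariant_subspace_def intro!: subspace_add subspace_scale)

lemma power_compact_imp_invariant_subspace:
  fixes D :: "'a::real_normed_vector \<Rightarrow> 'a"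
  assumes D: "bounded_linear D" "D \<noteq> (\<lambda>x. 0)" "compact_operator (D ^^ n)"
    and "\<not> compact_operator (\<lambda>x::'a. x)"
  shows "\<exists>Y. nontrivial_invariant_subspace D Y"
proof (cases "D ^^ n = (\<lambda>x. 0)")
  case True
  then show ?thesis using nilpotent_kernel_nontrivial[OF D(1,2)] by blast
next
  case False
  then show ?thesis by (rule lomonosov[OF D(1,3) _ _ assms(4)]) (simp add: funpow_swap1)
qed

text \<open>A polynomial in \<open>S\<close> without constant term is \<open>S R\<close> with \<open>R\<close> commuting with \<open>S\<close>.\<close>
lemma polynomial_nilpotent:
  fixes S :: "'a::real_normed_vector \<Rightarrow> 'a"
  assumes S: "bounded_linear S" "S ^^ k = (\<lambda>x. 0)"
  shows "(\<lambda>x. \<Sum>i<m. c i *\<^sub>R (S ^^ Suc i) x) ^^ k = (\<lambda>x. 0)"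
proof -
  interpret S: bounded_linear S by fact
  define R where "R x = (\<Sum>i<m. c i *\<^sub>R (S ^^ i) x)" for x
  have SR: "S (R x) = R (S x)" for x
    by (simp add: R_def S.sum S.scaleR funpow_swap1)
  have SmR: "(S ^^ j) (R x) = R ((S ^^ j) x)" for j x
    by (induction j) (simp_all add: SR)
  have Q: "(\<Sum>i<m. c i *\<^sub>R (S ^^ Suc i) x) = S (R x)" for x
    by (simp add: R_def S.sum S.scaleR)
  have "((\<lambda>x. S (R x)) ^^ j) x = (S ^^ j) ((R ^^ j) x)" for j x
    by (induction j) (simp_all add: SmR)
  then have "((\<lambda>x. S (R x)) ^^ k) = (\<lambda>x. 0)" using S(2) by auto
  then show ?thesis by (simp only: Q)
qed

theorem mainTheorem3:
  fixes k :: nat and S :: "'a::banach \<Rightarrow> 'a"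
  assumes "k \<ge> 2"
    and "separable_space (euclidean :: 'a topology)"
    and "script_L_infinity_space TYPE('a)"
    and "bounded_linear S"
    and "hereditarily_indecomposable TYPE('a)"
    and "isomorphic_to_l1 TYPE('a \<Rightarrow>\<^sub>L real)"
    and "\<not> compact_operator S"
    and "\<forall>j. 1 \<le> j \<and> j < k \<longrightarrow> S ^^ j \<noteq> (\<lambda>x. 0)"
    and "S ^^ k = (\<lambda>x. 0)"
    and "\<forall>j<k. \<forall>c :: nat \<Rightarrow> real.
           \<not> compact_operator (\<lambda>x. (S ^^ j) x - (\<Sum>l\<in>{..<k} - {j}. c l *\<^sub>R (S ^^ l) x))"
    and "strictly_singular S"
    and "\<forall>T :: 'a \<Rightarrow> 'a. bounded_linear T \<longrightarrow>
           (\<exists>(c :: nat \<Rightarrow> real) K. compact_operator K \<and>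
              T = (\<lambda>x. (\<Sum>i<k. c i *\<^sub>R (S ^^ i) x) + K x))"
  shows "\<forall>T :: 'a \<Rightarrow> 'a. bounded_linear T \<longrightarrow>
           (\<exists>Y. subspace Y \<and> closed Y \<and> Y \<noteq> {0} \<and> Y \<noteq> UNIV \<and> T ` Y \<subseteq> Y)"
proof (intro allI impI)
  fix T :: "'a \<Rightarrow> 'a" assume "bounded_linear T"
  note S = assms(4)
  obtain m where k: "k = Suc m" using assms(1) by (cases k) auto
  obtain c K where K: "compact_operator K" and T: "T = (\<lambda>x. (\<Sum>i<k. c i *\<^sub>R (S ^^ i) x) + K x)"
    using assms(12) \<open>bounded_linear T\<close> by blast
  \<comment> \<open>The hypothesis on \<open>S\<^sup>j\<close> for \<open>j = 0\<close> and vanishing coefficients.\<close>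
  have noncompact: "\<not> compact_operator (\<lambda>x::'a. x)"
    using assms(10)[rule_format, of 0 "\<lambda>_. 0"] k by simp
  define Q where "Q x = (\<Sum>i<m. c (Suc i) *\<^sub>R (S ^^ Suc i) x)" for x
  define D where "D x = Q x + K x" for x
  have TD: "T x = c 0 *\<^sub>R x + D x" for x
    unfolding T k D_def Q_def by (subst sum.lessThan_Suc_shift) (simp add: add.assoc)
  have Q: "bounded_linear Q"
    unfolding Q_def
    by (intro bounded_linear_sum bounded_linear_const_scaleR bounded_linear_funpow S)
  have D: "bounded_linear D"
    unfolding D_def using Q K by (auto simp: compact_operator_def intro: bounded_linear_add)
  have "\<exists>Y. nontrivial_invariant_subspace T Y"
  proof (cases "D = (\<lambda>x. 0)")
    case True
    have "S \<noteq> (\<lambda>x. 0)" using assms(1) assms(8)[rule_format, of 1] by simp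
    from nilpotent_kernel_nontrivial[OF S this assms(9)]
    have "nontrivial_invariant_subspace T {x. S x = 0}"
      using True by (auto simp: nontrivial_invariant_subspace_def TD subspace_scale
          linear_scale[OF bounded_linear.linear[OF S]])
    then show ?thesis by blast
  next
    case False
    have "Q ^^ k = (\<lambda>x. 0)"
      using polynomial_nilpotent[OF S assms(9), where m = m and c = "\<lambda>i. c (Suc i)"] by (simp add: Q_def[abs_def])
    then have "compact_operator (D ^^ k)"
      using funpow_compact_perturbation[OF Q K, of k] by (auto simp: D_def[abs_def])
    from power_compact_imp_invariant_subspace[OF D False this noncompact]
    show ?thesis using nontrivial_invariant_subspace_shift[OF _ TD] by blast
  qed
  then show "\<exists>Y. subspace Y \<and> closed Y \<and> Y \<noteq> {0} \<and> Y \<noteq> UNIV \<and> T ` Y \<subseteq> Y"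
    by (simp add: nontrivial_invariant_subspace_def)
qed

end
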